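(* For every BF-MWSAT instance with a continuous t-norm $\varphi$ and costs $c\in\mathbb{R}_{\ge0}^n$, the following hold. (1) The complete feasible set of the instance equals $\bigcup_e D(e)$, the union over all compatible complete witness assignments $e$. (2) For any compatible complete witness assignment $e$, the vector $x^*(e)$ defined by $x^*_j(e)=\min D_j(e)$, $j\in\mathcal{J}$, minimizes $c^Tx$ over $D(e)$. (3) Hence a global optimum is obtained by comparing the candidates $x^*(e)$ over compatible $e$: if the instance is feasible, then any $x^*(e)$ of smallest objective value $c^Tx^*(e)$ among all compatible complete witness assignments $e$ is a global optimal solution of the instance.
   Context: A t-norm is a commutative, associative map $\varphi:[0,1]^2\to[0,1]$, non-decreasing in each argument, with $\varphi(1,z)=z$. BF-MWSAT: let $\mathcal{I}=\{1,\dots,m\}$ (rows) and $\mathcal{J}=\{1,\dots,n\}$ (variables). Given $A^\pm=(a^\pm_{ij})\in[0,1]^{m\times n}$, $b\in[0,1]^m$, a continuous t-norm $\varphi$ and $c\in\mathbb{R}_{\ge0}^n$, minimize $c^Tx$ over $x\in[0,1]^n$ subject to $\max_{j\in\mathcal{J}}q_{ij}(x_j)=b_i$ for all $i\in\mathcal{I}$, where $q_{ij}(z)=\max\{\varphi(a^+_{ij},z),\varphi(a^-_{ij},1-z)\}$. Scalar sets: $I_{ij}=\{z\in[0,1]:q_{ij}(z)\le b_i\}$, $S_{ij}=\{z\in[0,1]:q_{ij}(z)=b_i\}$, $I_j=\bigcap_{i\in\mathcal{I}}I_{ij}$, $S'_{ij}=S_{ij}\cap I_j$, $J_i=\{j\in\mathcal{J}:S'_{ij}\ne\varnothing\}$.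 A complete witness assignment is a map $e:\mathcal{I}\to\mathcal{J}$ with $e(i)\in J_i$ for all $i\in\mathcal{I}$. Let $\mathcal{I}_j(e)=\{i\in\mathcal{I}:e(i)=j\}$. Put $D_j(e)=I_j$ if $\mathcal{I}_j(e)=\varnothing$, and $D_j(e)=\bigcap_{i\in\mathcal{I}_j(e)}S'_{ij}$ otherwise. The assignment $e$ is compatible if $D_j(e)\ne\varnothing$ for every $j\in\mathcal{J}$; then $D(e)=D_1(e)\times\cdots\times D_n(e)$. *)

theory Defs
  imports "HOL-Analysis.Analysis"
begin

definition t_norm :: "(real \<Rightarrow> real \<Rightarrow> real) \<Rightarrow> bool" where
  "t_norm \<phi> \<longleftrightarrow>
     (\<forall>x\<in>{0..1}. \<forall>y\<in>{0..1}. \<phi> x y \<in> {0..1}) \<and>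
     (\<forall>x\<in>{0..1}. \<forall>y\<in>{0..1}. \<phi> x y = \<phi> y x) \<and>
     (\<forall>x\<in>{0..1}. \<forall>y\<in>{0..1}. \<forall>z\<in>{0..1}. \<phi> (\<phi> x y) z = \<phi> x (\<phi> y z)) \<and>
     (\<forall>x\<in>{0..1}. \<forall>x'\<in>{0..1}. \<forall>y\<in>{0..1}. \<forall>y'\<in>{0..1}.
        x \<le> x' \<longrightarrow> y \<le> y' \<longrightarrow> \<phi> x y \<le> \<phi> x' y') \<and>
     (\<forall>z\<in>{0..1}. \<phi> 1 z = z)"

definition continuous_t_norm :: "(real \<Rightarrow> real \<Rightarrow> real) \<Rightarrow> bool" where
  "continuous_t_norm \<phi> \<longleftrightarrow>
     t_norm \<phi> \<and> continuous_on ({0..1} \<times> {0..1}) (\<lambda>(x, y). \<phi> x y)"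

text \<open>The rows and the variables are indexed by finite types \<open>'m\<close> and \<open>'n\<close>,
  so \<open>A $ i $ j\<close> is the entry in row \<open>i\<close> and column \<open>j\<close>.\<close>

definition bf_mwsat ::
  "(real \<Rightarrow> real \<Rightarrow> real) \<Rightarrow> real^'n^'m \<Rightarrow> real^'n^'m \<Rightarrow> real^'m \<Rightarrow> real^'n \<Rightarrow> bool" where
  "bf_mwsat \<phi> Ap Am b c \<longleftrightarrow>
     continuous_t_norm \<phi> \<and>
     (\<forall>i j. Ap $ i $ j \<in> {0..1}) \<and> (\<forall>i j. Am $ i $ j \<in> {0..1}) \<and>
     (\<forall>i. b $ i \<in> {0..1}) \<and> (\<forall>j. 0 \<le> c $ j)"

definition q ::
  "(real \<Rightarrow> real \<Rightarrow> real) \<Rightarrow> real^'n^'m \<Rightarrow> real^'n^'m \<Rightarrow> 'm \<Rightarrow> 'n \<Rightarrow> real \<Rightarrow> real" where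
  "q \<phi> Ap Am i j z = max (\<phi> (Ap $ i $ j) z) (\<phi> (Am $ i $ j) (1 - z))"

definition feasible_set ::
  "(real \<Rightarrow> real \<Rightarrow> real) \<Rightarrow> real^'n^'m \<Rightarrow> real^'n^'m \<Rightarrow> real^'m \<Rightarrow> (real^'n) set" where
  "feasible_set \<phi> Ap Am b =
     {x. (\<forall>j. x $ j \<in> {0..1}) \<and> (\<forall>i. (MAX j. q \<phi> Ap Am i j (x $ j)) = b $ i)}"

definition I_entry ::
  "(real \<Rightarrow> real \<Rightarrow> real) \<Rightarrow> real^'n^'m \<Rightarrow> real^'n^'m \<Rightarrow> real^'m \<Rightarrow> 'm \<Rightarrow> 'n \<Rightarrow> real set" where
  "I_entry \<phi> Ap Am b i j = {z \<in> {0..1}. q \<phi> Ap Am i j z \<le> b $ i}"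

definition S_entry ::
  "(real \<Rightarrow> real \<Rightarrow> real) \<Rightarrow> real^'n^'m \<Rightarrow> real^'n^'m \<Rightarrow> real^'m \<Rightarrow> 'm \<Rightarrow> 'n \<Rightarrow> real set" where
  "S_entry \<phi> Ap Am b i j = {z \<in> {0..1}. q \<phi> Ap Am i j z = b $ i}"

definition I_col ::
  "(real \<Rightarrow> real \<Rightarrow> real) \<Rightarrow> real^'n^'m \<Rightarrow> real^'n^'m \<Rightarrow> real^'m \<Rightarrow> 'n \<Rightarrow> real set" where
  "I_col \<phi> Ap Am b j = (\<Inter>i. I_entry \<phi> Ap Am b i j)"

definition S'_entry ::
  "(real \<Rightarrow> real \<Rightarrow> real) \<Rightarrow> real^'n^'m \<Rightarrow> real^'n^'m \<Rightarrow> real^'m \<Rightarrow> 'm \<Rightarrow> 'n \<Rightarrow> real set" where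
  "S'_entry \<phi> Ap Am b i j = S_entry \<phi> Ap Am b i j \<inter> I_col \<phi> Ap Am b j"

definition J_row ::
  "(real \<Rightarrow> real \<Rightarrow> real) \<Rightarrow> real^'n^'m \<Rightarrow> real^'n^'m \<Rightarrow> real^'m \<Rightarrow> 'm \<Rightarrow> 'n set" where
  "J_row \<phi> Ap Am b i = {j. S'_entry \<phi> Ap Am b i j \<noteq> {}}"

definition complete_witness_assignment ::
  "(real \<Rightarrow> real \<Rightarrow> real) \<Rightarrow> real^'n^'m \<Rightarrow> real^'n^'m \<Rightarrow> real^'m \<Rightarrow> ('m \<Rightarrow> 'n) \<Rightarrow> bool" where
  "complete_witness_assignment \<phi> Ap Am b e \<longleftrightarrow> (\<forall>i. e i \<in> J_row \<phi> Ap Am b i)"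

definition assigned_rows :: "('m \<Rightarrow> 'n) \<Rightarrow> 'n \<Rightarrow> 'm set" where
  "assigned_rows e j = {i. e i = j}"

definition D_col ::
  "(real \<Rightarrow> real \<Rightarrow> real) \<Rightarrow> real^'n^'m \<Rightarrow> real^'n^'m \<Rightarrow> real^'m \<Rightarrow> ('m \<Rightarrow> 'n) \<Rightarrow> 'n \<Rightarrow> real set"
where
  "D_col \<phi> Ap Am b e j =
     (if assigned_rows e j = {} then I_col \<phi> Ap Am b j
      else (\<Inter>i\<in>assigned_rows e j. S'_entry \<phi> Ap Am b i j))"

definition compatible_assignment ::
  "(real \<Rightarrow> real \<Rightarrow> real) \<Rightarrow> real^'n^'m \<Rightarrow> real^'n^'m \<Rightarrow> real^'m \<Rightarrow> ('m \<Rightarrow> 'n) \<Rightarrow> bool" where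
  "compatible_assignment \<phi> Ap Am b e \<longleftrightarrow>
     complete_witness_assignment \<phi> Ap Am b e \<and> (\<forall>j. D_col \<phi> Ap Am b e j \<noteq> {})"

definition D_box ::
  "(real \<Rightarrow> real \<Rightarrow> real) \<Rightarrow> real^'n^'m \<Rightarrow> real^'n^'m \<Rightarrow> real^'m \<Rightarrow> ('m \<Rightarrow> 'n) \<Rightarrow> (real^'n) set"
where
  "D_box \<phi> Ap Am b e = {x. \<forall>j. x $ j \<in> D_col \<phi> Ap Am b e j}"

text \<open>On the reals, \<open>LEAST\<close> is the minimum of the set when it is attained and is
  unspecified otherwise; that it is attained has to be shown separately.\<close>

definition x_star ::
  "(real \<Rightarrow> real \<Rightarrow> real) \<Rightarrow> real^'n^'m \<Rightarrow> real^'n^'m \<Rightarrow> real^'m \<Rightarrow> ('m \<Rightarrow> 'n) \<Rightarrow> real^'n" where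
  "x_star \<phi> Ap Am b e = (\<chi> j. LEAST z. z \<in> D_col \<phi> Ap Am b e j)"

definition minimizes_over :: "real^'n \<Rightarrow> (real^'n) set \<Rightarrow> real^'n \<Rightarrow> bool" where
  "minimizes_over c X x \<longleftrightarrow> is_arg_min (\<lambda>y. c \<bullet> y) (\<lambda>y. y \<in> X) x"

end

theory Submission
  imports Defs
begin

text \<open>A point is feasible iff no term of any row exceeds its right-hand side and each row has a
  column in which equality holds. Choosing such a column for every row is exactly a witness
  assignment \<open>e\<close>, and once \<open>e\<close> is fixed the conditions on the coordinates decouple: coordinate
  \<open>j\<close> has to lie in \<open>I_col\<close> and to attain equality in the rows assigned to \<open>j\<close>
  (\<open>mem_D_col_iff\<close>). So the feasible set is a union of boxes
  (\<open>feasible_set_eq_UN_D_box\<close>).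

  Continuity of the t-norm makes every side of such a box compact, so a nonempty side has a least
  element (\<open>compact_D_col\<close>, \<open>x_star_least\<close>). As the costs are nonnegative, the vector of these
  least elements is optimal on the box. There are only finitely many assignments, hence a best
  candidate exists whenever the problem is feasible, and it is optimal on the union because every
  feasible point lies in some box and is no cheaper than the candidate of that box.\<close>

text \<open>The terms of a row are continuous because each is a maximum of two sections of the t-norm, with
  the coefficients of the row in its domain.\<close>

lemma continuous_on_q:
  assumes "bf_mwsat \<phi> Ap Am b c"
  shows "continuous_on {0..1} (q \<phi> Ap Am i j)"
proof -
  have cont: "continuous_on ({0..1} \<times> {0..1}) (\<lambda>(x, y). \<phi> x y)"
    and a: "Ap $ i $ j \<in> {0..1}" "Am $ i $ j \<in> {0..1}"
    using assms by (auto simp: bf_mwsat_def continuous_t_norm_def)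
  have "continuous_on {0..1} (\<lambda>z. \<phi> (Ap $ i $ j) z)"
    using a by (intro continuous_on_compose2[OF cont,
        where f = "\<lambda>z. (Ap $ i $ j, z)", simplified])
      (auto intro!: continuous_intros)
  moreover have "continuous_on {0..1} (\<lambda>z. \<phi> (Am $ i $ j) (1 - z))"
    using a by (intro continuous_on_compose2[OF cont,
        where f = "\<lambda>z. (Am $ i $ j, 1 - z)", simplified])
      (auto intro!: continuous_intros)
  ultimately show ?thesis
    unfolding q_def[abs_def] by (rule continuous_on_max)
qed

text \<open>This removes the case distinction in \<open>D_col\<close>: the sets \<open>S'_entry\<close> are already cut
  down to \<open>I_col\<close>, so the column with no assigned row is not special.\<close>

lemma D_col_eq:
  "D_col \<phi> Ap Am b e j =
     I_col \<phi> Ap Am b j \<inter> (\<Inter>i\<in>assigned_rows e j. S_entry \<phi> Ap Am b i j)"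
  by (auto simp: D_col_def S'_entry_def)

lemma mem_D_col_iff:
  shows "z \<in> D_col \<phi> Ap Am b e j \<longleftrightarrow>
    z \<in> {0..1} \<and> (\<forall>i. q \<phi> Ap Am i j z \<le> b $ i) \<and> (\<forall>i. e i = j \<longrightarrow> q \<phi> Ap Am i j z = b $ i)"
  by (auto simp: D_col_eq I_col_def I_entry_def S_entry_def assigned_rows_def)

lemma compact_D_col:
  assumes "bf_mwsat \<phi> Ap Am b c"
  shows "compact (D_col \<phi> Ap Am b e j)"
proof -
  note cont = continuous_on_q[OF assms]
  have "closed (I_entry \<phi> Ap Am b i j)" for i
  proof -
    have "I_entry \<phi> Ap Am b i j = {0..1} \<inter> q \<phi> Ap Am i j -` {..b $ i}"
      by (auto simp: I_entry_def)
    then show ?thesis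
      by (simp add: continuous_closed_preimage[OF cont])
  qed
  moreover have "closed (S_entry \<phi> Ap Am b i j)" for i
  proof -
    have "S_entry \<phi> Ap Am b i j = {0..1} \<inter> q \<phi> Ap Am i j -` {b $ i}"
      by (auto simp: S_entry_def)
    then show ?thesis
      by (simp add: continuous_closed_preimage[OF cont])
  qed
  ultimately have "closed (D_col \<phi> Ap Am b e j)"
    by (auto simp: D_col_eq I_col_def)
  moreover have "D_col \<phi> Ap Am b e j \<subseteq> {0..1}"
    by (auto simp: mem_D_col_iff)
  ultimately show ?thesis
    using compact_Int_closed[OF compact_Icc] by (metis inf.absorb_iff2)
qed

lemma Least_mem_compact:
  fixes S :: "real set"
  assumes "compact S" "S \<noteq> {}"
  shows "(LEAST z. z \<in> S) \<in> S" "\<And>z. z \<in> S \<Longrightarrow> (LEAST z. z \<in> S) \<le> z"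
proof -
  obtain m where m: "m \<in> S" "\<And>z. z \<in> S \<Longrightarrow> m \<le> z"
    using compact_attains_inf[OF assms] by blast
  then have "(LEAST z. z \<in> S) = m"
    by (intro Least_equality) auto
  with m show "(LEAST z. z \<in> S) \<in> S" "\<And>z. z \<in> S \<Longrightarrow> (LEAST z. z \<in> S) \<le> z"
    by auto
qed

lemma x_star_least:
  assumes "bf_mwsat \<phi> Ap Am b c" and "compatible_assignment \<phi> Ap Am b e"
  shows "x_star \<phi> Ap Am b e $ j \<in> D_col \<phi> Ap Am b e j"
    and "z \<in> D_col \<phi> Ap Am b e j \<Longrightarrow> x_star \<phi> Ap Am b e $ j \<le> z"
  using Least_mem_compact[OF compact_D_col[OF assms(1)]] assms(2)
  by (simp_all add: compatible_assignment_def x_star_def)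

lemma mem_feasible_set_iff:
  shows "x \<in> feasible_set \<phi> Ap Am b \<longleftrightarrow>
    (\<forall>j. x $ j \<in> {0..1}) \<and>
    (\<forall>i. (\<forall>j. q \<phi> Ap Am i j (x $ j) \<le> b $ i) \<and> (\<exists>j. q \<phi> Ap Am i j (x $ j) = b $ i))"
proof -
  have "(MAX j. q \<phi> Ap Am i j (x $ j)) = b $ i \<longleftrightarrow>
    (\<forall>j. q \<phi> Ap Am i j (x $ j) \<le> b $ i) \<and> (\<exists>j. q \<phi> Ap Am i j (x $ j) = b $ i)" for i
    by (subst Max_eq_iff) (auto simp: image_iff eq_commute)
  then show ?thesis
    by (simp add: feasible_set_def)
qed

text \<open>Choosing, for each row of a feasible point, a column that attains equality gives an assignment
  whose box contains the point. Conversely, points of a box attain equality in row \<open>i\<close> at column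
  \<open>e i\<close>. Only compatible assignments contribute to the right-hand side, because the other boxes
  are empty (\<open>compatible_assignment_if_mem_D_box\<close>).\<close>

lemma mem_feasible_set_iff_D_box:
  "x \<in> feasible_set \<phi> Ap Am b \<longleftrightarrow> (\<exists>e. x \<in> D_box \<phi> Ap Am b e)"
proof
  assume "x \<in> feasible_set \<phi> Ap Am b"
  then have x: "\<forall>j. x $ j \<in> {0..1}" "\<forall>i j. q \<phi> Ap Am i j (x $ j) \<le> b $ i"
    and "\<forall>i. \<exists>j. q \<phi> Ap Am i j (x $ j) = b $ i"
    by (auto simp: mem_feasible_set_iff)
  then obtain e where "\<forall>i. q \<phi> Ap Am i (e i) (x $ e i) = b $ i"
    by metis
  with x have "x \<in> D_box \<phi> Ap Am b e"
    by (auto simp: D_box_def mem_D_col_iff)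
  then show "\<exists>e. x \<in> D_box \<phi> Ap Am b e" by blast
next
  assume "\<exists>e. x \<in> D_box \<phi> Ap Am b e"
  then show "x \<in> feasible_set \<phi> Ap Am b"
    unfolding mem_feasible_set_iff D_box_def by (auto simp: mem_D_col_iff)
qed

text \<open>One point of the box shows all its sides nonempty, and its coordinate at \<open>e i\<close> shows that
  \<open>e i\<close> is an admissible column for row \<open>i\<close>.\<close>

lemma compatible_assignment_if_mem_D_box:
  assumes "x \<in> D_box \<phi> Ap Am b e"
  shows "compatible_assignment \<phi> Ap Am b e"
proof -
  have x: "x $ j \<in> D_col \<phi> Ap Am b e j" for j
    using assms by (simp add: D_box_def)
  have "x $ e i \<in> S'_entry \<phi> Ap Am b i (e i)" for i
    using x[of "e i"] by (auto simp: D_col_eq S'_entry_def assigned_rows_def)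
  with x show ?thesis
    by (auto simp: compatible_assignment_def complete_witness_assignment_def J_row_def)
qed

lemma feasible_set_eq_UN_D_box:
  "feasible_set \<phi> Ap Am b = (\<Union>e\<in>{e. compatible_assignment \<phi> Ap Am b e}. D_box \<phi> Ap Am b e)"
  using compatible_assignment_if_mem_D_box by (fastforce simp: mem_feasible_set_iff_D_box)

lemma x_star_mem_D_box:
  assumes "bf_mwsat \<phi> Ap Am b c" and "compatible_assignment \<phi> Ap Am b e"
  shows "x_star \<phi> Ap Am b e \<in> D_box \<phi> Ap Am b e"
  using x_star_least(1)[OF assms] by (simp add: D_box_def)

text \<open>A lower bound in every coordinate is a lower bound for the objective, the costs being
  nonnegative.\<close>

lemma x_star_cost_le:
  assumes "bf_mwsat \<phi> Ap Am b c" and "x \<in> D_box \<phi> Ap Am b e"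
  shows "c \<bullet> x_star \<phi> Ap Am b e \<le> c \<bullet> x"
proof -
  have "x_star \<phi> Ap Am b e $ j \<le> x $ j" for j
    using x_star_least(2)[OF assms(1) compatible_assignment_if_mem_D_box[OF assms(2)]] assms(2)
    by (simp add: D_box_def)
  moreover have "0 \<le> c $ j" for j
    using assms(1) by (simp add: bf_mwsat_def)
  ultimately show ?thesis
    by (auto simp: inner_vec_def intro!: sum_mono mult_left_mono)
qed

lemma x_star_minimizes_D_box:
  assumes "bf_mwsat \<phi> Ap Am b c" and "compatible_assignment \<phi> Ap Am b e"
  shows "minimizes_over c (D_box \<phi> Ap Am b e) (x_star \<phi> Ap Am b e)"
  using x_star_mem_D_box[OF assms] x_star_cost_le[OF assms(1)]
  by (auto simp: minimizes_over_def is_arg_min_linorder)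

lemma ex_best_compatible_assignment:
  assumes "feasible_set \<phi> Ap Am b \<noteq> {}"
  shows "\<exists>e. is_arg_min (\<lambda>e. c \<bullet> x_star \<phi> Ap Am b e) (compatible_assignment \<phi> Ap Am b) e"
proof -
  have "{e. compatible_assignment \<phi> Ap Am b e} \<noteq> {}"
    using assms by (auto simp: feasible_set_eq_UN_D_box)
  from ex_is_arg_min_if_finite[OF finite this, of "\<lambda>e. c \<bullet> x_star \<phi> Ap Am b e"]
  show ?thesis
    by simp
qed

lemma best_x_star_minimizes_feasible_set:
  assumes "bf_mwsat \<phi> Ap Am b c"
    and best: "is_arg_min (\<lambda>e. c \<bullet> x_star \<phi> Ap Am b e) (compatible_assignment \<phi> Ap Am b) e"
  shows "minimizes_over c (feasible_set \<phi> Ap Am b) (x_star \<phi> Ap Am b e)"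
proof -
  have e: "compatible_assignment \<phi> Ap Am b e"
    and le: "\<And>e'. compatible_assignment \<phi> Ap Am b e' \<Longrightarrow>
      c \<bullet> x_star \<phi> Ap Am b e \<le> c \<bullet> x_star \<phi> Ap Am b e'"
    using best by (auto simp: is_arg_min_linorder)
  have "x_star \<phi> Ap Am b e \<in> feasible_set \<phi> Ap Am b"
    using x_star_mem_D_box[OF assms(1) e] by (auto simp: mem_feasible_set_iff_D_box)
  moreover have "c \<bullet> x_star \<phi> Ap Am b e \<le> c \<bullet> x" if x: "x \<in> feasible_set \<phi> Ap Am b" for x
  proof -
    obtain e' where e': "compatible_assignment \<phi> Ap Am b e'" "x \<in> D_box \<phi> Ap Am b e'"
      using x by (auto simp: feasible_set_eq_UN_D_box)
    show ?thesis
      using le[OF e'(1)] x_star_cost_le[OF assms(1) e'(2)] by linarith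
  qed
  ultimately show ?thesis
    by (simp add: minimizes_over_def is_arg_min_linorder)
qed

theorem theorem8:
  fixes \<phi> :: "real \<Rightarrow> real \<Rightarrow> real"
    and Ap Am :: "real^'n^'m"
    and b :: "real^'m"
    and c :: "real^'n"
  assumes "bf_mwsat \<phi> Ap Am b c"
  shows
    "feasible_set \<phi> Ap Am b = (\<Union>e\<in>{e. compatible_assignment \<phi> Ap Am b e}. D_box \<phi> Ap Am b e)
     \<and> (\<forall>e. compatible_assignment \<phi> Ap Am b e \<longrightarrow>
          (\<forall>j. x_star \<phi> Ap Am b e $ j \<in> D_col \<phi> Ap Am b e j \<and>
               (\<forall>z\<in>D_col \<phi> Ap Am b e j. x_star \<phi> Ap Am b e $ j \<le> z)) \<and>
          minimizes_over c (D_box \<phi> Ap Am b e) (x_star \<phi> Ap Am b e))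
     \<and> (feasible_set \<phi> Ap Am b \<noteq> {} \<longrightarrow>
          (\<exists>e. is_arg_min (\<lambda>e. c \<bullet> x_star \<phi> Ap Am b e) (compatible_assignment \<phi> Ap Am b) e) \<and>
          (\<forall>e. is_arg_min (\<lambda>e. c \<bullet> x_star \<phi> Ap Am b e) (compatible_assignment \<phi> Ap Am b) e \<longrightarrow>
               minimizes_over c (feasible_set \<phi> Ap Am b) (x_star \<phi> Ap Am b e)))"
  using assms
  by (intro conjI allI impI ballI)
    (simp_all add: feasible_set_eq_UN_D_box[symmetric] x_star_least x_star_minimizes_D_box
      ex_best_compatible_assignment best_x_star_minimizes_feasible_set)

end
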